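(* Let $X$ and $X_n$, $n=1,2,\dots$, be mm-spaces, $\nu$ and $\nu_n$, $n=1,2,\dots$, Borel probability measures on $\mathbb{R}$, and $\varepsilon_n$, $n=1,2,\dots$, non-negative real numbers. Assume that $X_n$ converges to $X$ with respect to the observable distance $d_{\mathrm{conc}}$, that $\nu_n$ converges weakly to $\nu$, and that $\varepsilon_n$ converges to a real number $\varepsilon$ as $n\to\infty$. Assume that $\nu_n$ is an $\varepsilon_n$-iso-dominant of $X_n$ for every positive integer $n$. Then $\nu$ is an $\varepsilon$-iso-dominant of $X$.
   Context: An mm-space is a triple $X=(X,d_X,m_X)$ where $(X,d_X)$ is a complete separable metric space and $m_X$ is a Borel probability measure on $X$. 1-Lipschitz means Lipschitz with constant at most $1$. The 1-measurement of $X$ is $\mathcal{M}(X;1):=\{\varphi_*m_X\mid \varphi:X\to\mathbb{R}\ \text{1-Lipschitz}\}$, where $\varphi_*m_X$ is the push-forward. For $S\subset\mathbb{R}^2$, $\operatorname{dev}_\succ S:=\sup\{y-y'-\max\{x-x',0\}\mid (x,y),(x',y')\in S\}$. For Borel probability measures $\mu,\nu$ on $\mathbb{R}$, $\Pi(\mu,\nu)$ is the set of Borel probability measures on $\mathbb{R}^2$ with first marginal $\mu$ and second marginal $\nu$. For $s,t\ge 0$, write $\mu\succ'_{(s,t)}\nu$ if there exist $\pi\in\Pi(\mu,\nu)$ and a Borel set $S\subset\mathbb{R}^2$ with $\operatorname{dev}_\succ S\le s$ and $1-\pi(S)\le t$. For $\varepsilon\ge 0$, $\nu$ is an $\varepsilon$-iso-dominant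 of $X$ if $\nu\succ'_{(\varepsilon,0)}\mu$ for all $\mu\in\mathcal{M}(X;1)$. Observable distance: let $I=[0,1)$ with one-dimensional Lebesgue measure $\mathcal{L}^1$. A parameter of $X$ is a Borel measurable map $\varphi:I\to X$ with $\varphi_*\mathcal{L}^1=m_X$. For Borel measurable $f,g:I\to\mathbb{R}$ put $d_{\mathrm{KF}}(f,g):=\inf\{\varepsilon\ge 0\mid \mathcal{L}^1(\{t\in I\mid |f(t)-g(t)|>\varepsilon\})\le\varepsilon\}$, and let $d_{\mathrm{H}}^{\mathrm{KF}}$ be the Hausdorff distance with respect to $d_{\mathrm{KF}}$. For a parameter $\varphi$ of $X$ put $\varphi^*\mathcal{L}ip_1(X):=\{f\circ\varphi\mid f:X\to\mathbb{R}\ \text{1-Lipschitz}\}$. Then $d_{\mathrm{conc}}(X,Y):=\inf_{\varphi,\psi}d_{\mathrm{H}}^{\mathrm{KF}}(\varphi^*\mathcal{L}ip_1(X),\psi^*\mathcal{L}ip_1(Y))$, where $\varphi,\psi$ run over all parameters of $X$ and $Y$ respectively. *)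

theory Defs
  imports "HOL-Probability.Probability"
begin

text \<open>
  Spaces are carried by subsets of a type (via the library's abstract metrics), so that a
  sequence of different mm-spaces can be expressed.  A space is a pair of its metric and its
  measure.
\<close>

type_synonym 'a mmspace = "'a metric \<times> 'a measure"

definition metric_borel :: "'a metric \<Rightarrow> 'a measure" where
  "metric_borel d = sigma (mspace d) {U. openin (mtopology_of d) U}"

definition mm_space :: "'a mmspace \<Rightarrow> bool" where
  "mm_space X \<longleftrightarrow>
     mcomplete_of (fst X) \<and> separable_space (mtopology_of (fst X)) \<and>
     sets (snd X) = sets (metric_borel (fst X)) \<and> prob_space (snd X)"

text \<open>The values of a member of \<open>Lip1 d\<close> outside \<open>mspace d\<close> are irrelevant: both uses below, the
  push-forward of a measure on \<open>mspace d\<close> and the composition with a parameter compared on the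
  unit interval, only see its restriction to \<open>mspace d\<close>.\<close>

definition Lip1 :: "'a metric \<Rightarrow> ('a \<Rightarrow> real) set" where
  "Lip1 d = {f. \<forall>x\<in>mspace d. \<forall>y\<in>mspace d. \<bar>f x - f y\<bar> \<le> mdist d x y}"

definition measurement1 :: "'a mmspace \<Rightarrow> real measure set" where
  "measurement1 X = (\<lambda>f. distr (snd X) borel f) ` Lip1 (fst X)"

text \<open>The supremum is taken in the extended reals; it is \<open>-\<infinity>\<close> for the empty set.\<close>

definition dev_succ :: "(real \<times> real) set \<Rightarrow> ereal" where
  "dev_succ S = Sup {ereal (y - y' - max (x - x') 0) | x y x' y'. (x, y) \<in> S \<and> (x', y') \<in> S}"

definition couplings :: "real measure \<Rightarrow> real measure \<Rightarrow> (real \<times> real) measure set" where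
  "couplings \<mu> \<nu> = {\<pi>. prob_space \<pi> \<and> sets \<pi> = sets borel \<and>
     distr \<pi> borel fst = \<mu> \<and> distr \<pi> borel snd = \<nu>}"

text \<open>\<open>succ_err s t \<mu> \<nu>\<close> renders \<open>\<mu> \<succ>'_(s,t) \<nu>\<close>.\<close>

definition succ_err :: "real \<Rightarrow> real \<Rightarrow> real measure \<Rightarrow> real measure \<Rightarrow> bool" where
  "succ_err s t \<mu> \<nu> \<longleftrightarrow>
     (\<exists>\<pi>\<in>couplings \<mu> \<nu>. \<exists>S\<in>sets borel. dev_succ S \<le> ereal s \<and> 1 - measure \<pi> S \<le> t)"

definition iso_dominant :: "real \<Rightarrow> 'a mmspace \<Rightarrow> real measure \<Rightarrow> bool" where
  "iso_dominant \<epsilon> X \<nu> \<longleftrightarrow> (\<forall>\<mu>\<in>measurement1 X. succ_err \<epsilon> 0 \<nu> \<mu>)"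

abbreviation unit_interval_measure :: "real measure" where
  "unit_interval_measure \<equiv> restrict_space lborel {0..<1}"

definition parameters :: "'a mmspace \<Rightarrow> (real \<Rightarrow> 'a) set" where
  "parameters X = {\<phi>. \<phi> \<in> measurable unit_interval_measure (snd X) \<and>
     distr unit_interval_measure (snd X) \<phi> = snd X}"

text \<open>The set below always contains 1, so the real infimum is well behaved.\<close>

definition dKF :: "(real \<Rightarrow> real) \<Rightarrow> (real \<Rightarrow> real) \<Rightarrow> real" where
  "dKF f g = Inf {\<epsilon>. 0 \<le> \<epsilon> \<and>
     measure unit_interval_measure {t\<in>{0..<1}. \<bar>f t - g t\<bar> > \<epsilon>} \<le> \<epsilon>}"

definition hausdorff_distance :: "('b \<Rightarrow> 'b \<Rightarrow> real) \<Rightarrow> 'b set \<Rightarrow> 'b set \<Rightarrow> ennreal" where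
  "hausdorff_distance d A B =
     max (SUP a\<in>A. INF b\<in>B. ennreal (d a b)) (SUP b\<in>B. INF a\<in>A. ennreal (d a b))"

definition param_Lip1 :: "(real \<Rightarrow> 'a) \<Rightarrow> 'a mmspace \<Rightarrow> (real \<Rightarrow> real) set" where
  "param_Lip1 \<phi> X = (\<lambda>f. f \<circ> \<phi>) ` Lip1 (fst X)"

text \<open>Values in \<open>ennreal\<close> make the infimum independent of any prior existence result for
  parameters.\<close>

definition dconc :: "'a mmspace \<Rightarrow> 'b mmspace \<Rightarrow> ennreal" where
  "dconc X Y = (INF \<phi>\<in>parameters X. INF \<psi>\<in>parameters Y.
     hausdorff_distance dKF (param_Lip1 \<phi> X) (param_Lip1 \<psi> Y))"

end

theory Submission
  imports Defs
begin

text \<open>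
  The relation \<open>\<mu> \<succ>'_(s,0) \<nu>\<close> asks for a coupling of \<open>\<mu>\<close> and \<open>\<nu>\<close> that is
  carried by a set of deviation at most \<open>s\<close>. Instead of extracting a limit from a sequence of
  couplings, the proof removes the coupling from the relation: writing \<open>F\<close> and \<open>G\<close> for the
  distribution functions of \<open>\<mu>\<close> and \<open>\<nu>\<close>, the relation is equivalent to
  \[ F(x') < G(y'),\ G(y) < F(x) \implies y - y' \le s + \max\{x - x', 0\}. \]
  If a good coupling is given, then \<open>F(x') < G(y')\<close> forces its carrier to have a point strictly to
  the right of \<open>x'\<close> and not above \<open>y'\<close>, while \<open>G(y) < F(x)\<close> forces it to have a point not to the
  right of \<open>x\<close> and strictly above \<open>y\<close>; the deviation bound for these two points gives the
  inequality (\<open>succ_err_zero_imp_cdf_gap\<close>). Conversely, the inequality bounds the deviation of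
  the curve traced by the two quantile functions, and the closure of this curve carries the quantile
  coupling (\<open>cdf_gap_imp_succ_err_zero\<close>).

  The distribution function inequality is stable under weak convergence, because its hypotheses are
  strict and survive small shifts to the right, to points where the functions are continuous
  (\<open>succ_err_zero_weak_limit\<close>).

  What remains is to approximate each measurement of the limit space. If
  \<open>X\<^sub>n\<close> is close to \<open>X\<close> in the observable distance, then for each 1-Lipschitz function \<open>f\<close> on \<open>X\<close>
  some 1-Lipschitz function on \<open>X\<^sub>n\<close> is close in measure to \<open>f\<close> after composition with suitable
  parameters. Parameters do not change the laws, so the law of \<open>f\<close> is a weak
  limit of measurements of the \<open>X\<^sub>n\<close> (\<open>measurement1_weak_approximation\<close>).
\<close>

section \<open>The relation with zero mass defect in terms of distribution functions\<close>

lemma dev_succ_le_iff: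
  "dev_succ S \<le> ereal s \<longleftrightarrow>
    (\<forall>x y x' y'. (x, y) \<in> S \<longrightarrow> (x', y') \<in> S \<longrightarrow> y - y' \<le> s + max (x - x') 0)"
  unfolding dev_succ_def Sup_le_iff by (force simp: algebra_simps)

text \<open>The deviation bound is a closed condition on pairs of points. This allows a carrier to be
  replaced by its closure, which is Borel even when the carrier is only given as an image.\<close>

lemma dev_succ_closure_le:
  assumes "dev_succ A \<le> ereal s"
  shows "dev_succ (closure A) \<le> ereal s"
  unfolding dev_succ_le_iff
proof (intro allI impI)
  fix x y x' y' assume "(x, y) \<in> closure A" "(x', y') \<in> closure A"
  then obtain p q where p: "\<And>n. p n \<in> A" "p \<longlonglongrightarrow> (x, y)" and q: "\<And>n. q n \<in> A" "q \<longlonglongrightarrow> (x', y')"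
    unfolding closure_sequential by blast
  have "snd (p n) - snd (q n) \<le> s + max (fst (p n) - fst (q n)) 0" for n
    using assms p(1)[of n] q(1)[of n] unfolding dev_succ_le_iff by (metis prod.collapse)
  moreover have "(\<lambda>n. snd (p n) - snd (q n)) \<longlonglongrightarrow> snd (x, y) - snd (x', y')"
    by (intro tendsto_intros p q)
  moreover have "(\<lambda>n. s + max (fst (p n) - fst (q n)) 0) \<longlonglongrightarrow> s + max (fst (x, y) - fst (x', y')) 0"
    by (intro tendsto_intros tendsto_max p q)
  ultimately show "y - y' \<le> s + max (x - x') 0"
    using LIMSEQ_le[of _ "snd (x, y) - snd (x', y')"] by fastforce
qed

definition cdf_gap :: "real \<Rightarrow> real measure \<Rightarrow> real measure \<Rightarrow> bool" where
  "cdf_gap s \<mu> \<nu> \<longleftrightarrow> (\<forall>x y x' y'. cdf \<mu> x' < cdf \<nu> y' \<longrightarrow> cdf \<nu> y < cdf \<mu> x \<longrightarrow>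
     y - y' \<le> s + max (x - x') 0)"

text \<open>This turns a strict inequality between distribution functions into a point of the carrier:
  removing the less likely event from the more likely one leaves positive probability.\<close>

lemma (in prob_space) full_set_meets_Diff:
  assumes "S \<in> events" "prob S = 1" "A \<in> events" "B \<in> events" "prob A < prob B"
  shows "S \<inter> (B - A) \<noteq> {}"
proof
  assume "S \<inter> (B - A) = {}"
  moreover have "prob (S \<inter> (B - A)) = prob (B - A)"
    using assms by (metis Int_commute measure_space_inter prob_space sets.Diff)
  moreover have "prob B \<le> prob (B - A) + prob A"
    using assms measure_Un_le[of "B - A" M A] finite_measure_mono[of B "B - A \<union> A"] by auto
  ultimately show False
    using assms by simp
qed

lemma succ_err_zero_imp_cdf_gap:
  assumes "succ_err s 0 \<mu> \<nu>"
  shows "cdf_gap s \<mu> \<nu>"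
proof -
  from assms obtain \<pi> S where "prob_space \<pi>" and sets[measurable_cong]: "sets \<pi> = sets borel"
    and marg: "distr \<pi> borel fst = \<mu>" "distr \<pi> borel snd = \<nu>"
    and S: "S \<in> sets borel" "dev_succ S \<le> ereal s" "1 - measure \<pi> S \<le> 0"
    unfolding succ_err_def couplings_def by blast
  interpret prob_space \<pi> by fact
  have space: "space \<pi> = UNIV"
    using sets_eq_imp_space_eq[OF sets] by simp
  have [measurable]: "fst \<in> borel_measurable \<pi>" "snd \<in> borel_measurable \<pi>"
    by (simp_all add: measurable_cong_sets[OF sets refl] borel_measurable_continuous_onI
        continuous_on_fst continuous_on_snd)
  have cdf: "cdf \<mu> a = prob {p. fst p \<le> a}" "cdf \<nu> b = prob {p. snd p \<le> b}"
    and events: "{p. fst p \<le> a} \<in> events" "{p. snd p \<le> b} \<in> events" for a b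
  proof -
    show "cdf \<mu> a = prob {p. fst p \<le> a}" "cdf \<nu> b = prob {p. snd p \<le> b}"
      by (simp_all add: cdf_def marg[symmetric] measure_distr space vimage_def)
    show "{p. fst p \<le> a} \<in> events" "{p. snd p \<le> b} \<in> events"
      using measurable_sets[of fst \<pi> borel "{..a}"] measurable_sets[of snd \<pi> borel "{..b}"]
      by (simp_all add: space vimage_def)
  qed
  have full: "S \<in> events" "prob S = 1"
    using S sets prob_le_1[of S] by auto
  show ?thesis
    unfolding cdf_gap_def
  proof (intro allI impI)
    fix x y x' y' assume "cdf \<mu> x' < cdf \<nu> y'" "cdf \<nu> y < cdf \<mu> x"
    then have "S \<inter> ({p. snd p \<le> y'} - {p. fst p \<le> x'}) \<noteq> {}"
        "S \<inter> ({p. fst p \<le> x} - {p. snd p \<le> y}) \<noteq> {}"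
      by (simp_all add: cdf full_set_meets_Diff full events)
    then obtain p q where pq: "p \<in> S" "x' < fst p" "snd p \<le> y'" "q \<in> S" "fst q \<le> x" "y < snd q"
      by (auto simp only: ex_in_conv[symmetric] Int_iff Diff_iff mem_Collect_eq not_le)
    then have "snd q - snd p \<le> s + max (fst q - fst p) 0"
      using S(2) unfolding dev_succ_le_iff by (metis prod.collapse)
    then show "y - y' \<le> s + max (x - x') 0"
      using pq by linarith
  qed
qed

text \<open>The monotone coupling, which pairs the two quantile functions over one uniform variable, is a
  good coupling whenever there is any: for levels \<open>t\<close> and \<open>t'\<close> the four quantiles can be
  compared through the distribution functions alone.\<close>

lemma cdf_gap_imp_succ_err_zero:
  assumes \<mu>: "real_distribution \<mu>" and \<nu>: "real_distribution \<nu>" and gap: "cdf_gap s \<mu> \<nu>"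
  shows "succ_err s 0 \<mu> \<nu>"
proof -
  interpret \<mu>: cdf_distribution \<mu> by (simp add: cdf_distribution_def \<mu>)
  interpret \<nu>: cdf_distribution \<nu> by (simp add: cdf_distribution_def \<nu>)
  let ?\<Omega> = "restrict_space lborel {0<..<1::real}"
  interpret \<Omega>: prob_space ?\<Omega>
    by (auto simp: space_restrict_space emeasure_restrict_space intro!: prob_spaceI)
  define q where "q t = (\<mu>.I t, \<nu>.I t)" for t
  have meas[measurable]: "\<mu>.I \<in> borel_measurable ?\<Omega>" "\<nu>.I \<in> borel_measurable ?\<Omega>"
    using \<mu>.measurable_CI \<nu>.measurable_CI
    by (simp_all cong: measurable_cong_sets add: sets_restrict_space)
  have q[measurable]: "q \<in> borel_measurable ?\<Omega>"
    unfolding q_def by measurable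
  define S where "S = closure (q ` {0<..<1})"
  have "dev_succ (q ` {0<..<1}) \<le> ereal s"
    unfolding dev_succ_le_iff
  proof (intro allI impI)
    fix x y x' y' assume "(x, y) \<in> q ` {0<..<1}" "(x', y') \<in> q ` {0<..<1}"
    then obtain t t' where t: "t \<in> {0<..<1}" "x = \<mu>.I t" "y = \<nu>.I t"
      and t': "t' \<in> {0<..<1}" "x' = \<mu>.I t'" "y' = \<nu>.I t'"
      by (auto simp: q_def)
    show "y - y' \<le> s + max (x - x') 0"
    proof (rule field_le_epsilon)
      fix e :: real assume "0 < e"
      \<comment> \<open>The distribution function is at least the level at the quantile and strictly below the
        level to the left of it, so \<open>t'\<close> separates the first two values and \<open>t\<close> the last two.\<close>
      have "cdf \<mu> (x' - e / 2) < cdf \<nu> y'"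
        using \<open>0 < e\<close> t' \<mu>.pseudoinverse[of t' "x' - e / 2"] \<nu>.pseudoinverse[of t' y'] by auto
      moreover have "cdf \<nu> (y - e / 2) < cdf \<mu> x"
        using \<open>0 < e\<close> t \<nu>.pseudoinverse[of t "y - e / 2"] \<mu>.pseudoinverse[of t x] by auto
      ultimately have "(y - e / 2) - y' \<le> s + max (x - (x' - e / 2)) 0"
        using gap unfolding cdf_gap_def by blast
      then show "y - y' \<le> s + max (x - x') 0 + e"
        using \<open>0 < e\<close> by linarith
    qed
  qed
  then have "dev_succ S \<le> ereal s"
    unfolding S_def by (rule dev_succ_closure_le)
  moreover have S: "S \<in> sets borel"
    by (simp add: S_def)
  moreover have "measure (distr ?\<Omega> borel q) S = 1"
  proof -
    have "q -` S \<inter> space ?\<Omega> = space ?\<Omega>"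
      using closure_subset[of "q ` {0<..<1}"] by (auto simp: S_def space_restrict_space)
    then show ?thesis
      by (simp only: measure_distr[OF q S] \<Omega>.prob_space)
  qed
  moreover have "distr ?\<Omega> borel q \<in> couplings \<mu> \<nu>"
    using \<mu>.distr_I_eq_M \<nu>.distr_I_eq_M \<Omega>.prob_space_distr[OF q]
    by (simp add: couplings_def distr_distr comp_def q_def borel_measurable_continuous_onI
        continuous_on_fst continuous_on_snd)
  ultimately show ?thesis
    unfolding succ_err_def by (metis diff_self order_refl)
qed

section \<open>Stability under weak convergence\<close>

lemma continuity_point_right:
  assumes "real_distribution \<mu>" "0 < (e::real)"
  obtains z where "x < z" "z < x + e" "isCont (cdf \<mu>) z"
proof -
  interpret real_distribution \<mu> by fact
  show thesis
    using open_minus_countable[OF countable_support, of "{x<..<x + e}"] \<open>0 < e\<close> that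
    by (auto simp: isCont_cdf)
qed

text \<open>Right continuity keeps the smaller side of a strict inequality small after a shift to the
  right, and monotonicity keeps the larger side large. Both sides can thus be moved to points of
  continuity of their distribution functions, where weak convergence is pointwise.\<close>

lemma cdf_less_perturb:
  assumes \<mu>: "real_distribution \<mu>" and \<nu>: "real_distribution \<nu>"
    and conv: "weak_conv_m \<mu>s \<mu>" "weak_conv_m \<nu>s \<nu>"
    and less: "cdf \<mu> a < cdf \<nu> b" and "0 < e"
  obtains a' b' where "a < a'" "a' < a + e" "b < b'" "b' < b + e"
    "\<forall>\<^sub>F n in sequentially. cdf (\<mu>s n) a' < cdf (\<nu>s n) b'"
proof -
  interpret \<mu>: real_distribution \<mu> by fact
  interpret \<nu>: real_distribution \<nu> by fact
  have "(cdf \<mu> \<longlongrightarrow> cdf \<mu> a) (at_right a)"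
    using \<mu>.cdf_is_right_cont by (simp add: continuous_within)
  then have "\<forall>\<^sub>F z in at_right a. cdf \<mu> z < cdf \<nu> b"
    using less by (rule order_tendstoD)
  then obtain c where c: "a < c" "\<And>z. a < z \<Longrightarrow> z < c \<Longrightarrow> cdf \<mu> z < cdf \<nu> b"
    unfolding eventually_at_right_field by blast
  obtain a' where a': "a < a'" "a' < a + min e (c - a)" "isCont (cdf \<mu>) a'"
    using continuity_point_right[OF \<mu>, of "min e (c - a)" a] c(1) \<open>0 < e\<close> by auto
  obtain b' where b': "b < b'" "b' < b + e" "isCont (cdf \<nu>) b'"
    using continuity_point_right[OF \<nu> \<open>0 < e\<close>] by blast
  have "cdf \<mu> a' < cdf \<nu> b"
    using c(2) a' by simp
  also have "\<dots> \<le> cdf \<nu> b'"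
    using b' by (intro \<nu>.cdf_nondecreasing) simp
  finally have "cdf \<mu> a' < cdf \<nu> b'" .
  moreover have "(\<lambda>n. cdf (\<mu>s n) a') \<longlonglongrightarrow> cdf \<mu> a'" "(\<lambda>n. cdf (\<nu>s n) b') \<longlonglongrightarrow> cdf \<nu> b'"
    using conv a' b' by (auto simp: weak_conv_m_def weak_conv_def)
  moreover obtain r where "cdf \<mu> a' < r" "r < cdf \<nu> b'"
    using dense[OF calculation(1)] by blast
  ultimately have "\<forall>\<^sub>F n in sequentially. cdf (\<mu>s n) a' < r"
      "\<forall>\<^sub>F n in sequentially. r < cdf (\<nu>s n) b'"
    using order_tendstoD by blast+
  then have "\<forall>\<^sub>F n in sequentially. cdf (\<mu>s n) a' < cdf (\<nu>s n) b'"
    by eventually_elim simp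
  then show thesis
    using that a' b' by auto
qed

theorem succ_err_zero_weak_limit:
  assumes \<mu>: "real_distribution \<mu>" and \<nu>: "real_distribution \<nu>"
    and conv: "weak_conv_m \<mu>s \<mu>" "weak_conv_m \<nu>s \<nu>" and s: "ss \<longlonglongrightarrow> s"
    and succ: "\<forall>\<^sub>F n in sequentially. succ_err (ss n) 0 (\<mu>s n) (\<nu>s n)"
  shows "succ_err s 0 \<mu> \<nu>"
proof (rule cdf_gap_imp_succ_err_zero[OF \<mu> \<nu>], unfold cdf_gap_def, intro allI impI)
  fix x y x' y' assume less: "cdf \<mu> x' < cdf \<nu> y'" "cdf \<nu> y < cdf \<mu> x"
  show "y - y' \<le> s + max (x - x') 0"
  proof (rule field_le_epsilon)
    fix e :: real assume "0 < e"
    then have e: "0 < e / 2" by simp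
    obtain a' b' where 1: "x' < a'" "a' < x' + e / 2" "y' < b'" "b' < y' + e / 2"
        "\<forall>\<^sub>F n in sequentially. cdf (\<mu>s n) a' < cdf (\<nu>s n) b'"
      using cdf_less_perturb[OF \<mu> \<nu> conv less(1) e] by blast
    obtain b a where 2: "y < b" "b < y + e / 2" "x < a" "a < x + e / 2"
        "\<forall>\<^sub>F n in sequentially. cdf (\<nu>s n) b < cdf (\<mu>s n) a"
      using cdf_less_perturb[OF \<nu> \<mu> conv(2,1) less(2) e] by blast
    have "\<forall>\<^sub>F n in sequentially. b - b' \<le> ss n + max (a - a') 0"
      using 1(5) 2(5) succ
    proof eventually_elim
      case (elim n)
      then show ?case
        using succ_err_zero_imp_cdf_gap[OF elim(3)] unfolding cdf_gap_def by blast
    qed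
    then have "b - b' \<le> s + max (a - a') 0"
      by (intro tendsto_lowerbound[OF tendsto_add[OF s tendsto_const]]) auto
    then show "y - y' \<le> s + max (x - x') 0 + e"
      using 1 2 by linarith
  qed
qed

section \<open>Closeness in measure and laws\<close>

lemma (in prob_space) cdf_distr_le_shift:
  fixes f g :: "'a \<Rightarrow> real"
  assumes [measurable]: "f \<in> borel_measurable M" "g \<in> borel_measurable M"
    and "prob {t \<in> space M. \<delta> < \<bar>f t - g t\<bar>} \<le> \<delta>"
  shows "cdf (distr M borel f) x \<le> cdf (distr M borel g) (x + \<delta>) + \<delta>"
proof -
  have cdf: "cdf (distr M borel h) z = prob {t \<in> space M. h t \<le> z}"
    if [measurable]: "h \<in> borel_measurable M" for h z
    by (auto simp: cdf_def measure_distr intro!: arg_cong[where f = prob])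
  have "prob {t \<in> space M. f t \<le> x}
      \<le> prob ({t \<in> space M. g t \<le> x + \<delta>} \<union> {t \<in> space M. \<delta> < \<bar>f t - g t\<bar>})"
    by (intro finite_measure_mono) auto
  also have "\<dots> \<le> prob {t \<in> space M. g t \<le> x + \<delta>} + prob {t \<in> space M. \<delta> < \<bar>f t - g t\<bar>}"
    by (intro measure_Un_le) auto
  finally show ?thesis
    using assms by (simp add: cdf)
qed

text \<open>Convergence in probability implies convergence in distribution. The limit law may be
  realised by a different function at each index, since each comparison with it only uses the law.\<close>

lemma (in prob_space) weak_conv_m_of_close_in_measure:
  fixes f g :: "nat \<Rightarrow> 'a \<Rightarrow> real"
  assumes close: "\<And>\<delta>. 0 < \<delta> \<Longrightarrow> \<forall>\<^sub>F n in sequentially.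
      f n \<in> borel_measurable M \<and> g n \<in> borel_measurable M \<and>
      distr M borel (f n) = \<mu>s n \<and> distr M borel (g n) = \<mu> \<and>
      prob {t \<in> space M. \<delta> < \<bar>f n t - g n t\<bar>} \<le> \<delta>"
  shows "weak_conv_m \<mu>s \<mu>"
  unfolding weak_conv_m_def weak_conv_def
proof (intro allI impI)
  fix x assume cont: "isCont (cdf \<mu>) x"
  show "(\<lambda>n. cdf (\<mu>s n) x) \<longlonglongrightarrow> cdf \<mu> x"
  proof (rule tendstoI)
    fix e :: real assume "0 < e"
    then obtain d where d: "0 < d" "\<And>z. \<bar>z - x\<bar> < d \<Longrightarrow> \<bar>cdf \<mu> z - cdf \<mu> x\<bar> < e / 2"
      using cont unfolding continuous_at_eps_delta dist_real_def by (metis half_gt_zero)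
    define \<delta> where "\<delta> = min (d / 2) (e / 2)"
    have \<delta>: "0 < \<delta>" "\<delta> < d" "\<delta> \<le> e / 2"
      using d(1) \<open>0 < e\<close> by (auto simp: \<delta>_def min_def)
    show "\<forall>\<^sub>F n in sequentially. dist (cdf (\<mu>s n) x) (cdf \<mu> x) < e"
      using close[OF \<delta>(1)]
    proof eventually_elim
      case (elim n)
      have "{t \<in> space M. \<delta> < \<bar>g n t - f n t\<bar>} = {t \<in> space M. \<delta> < \<bar>f n t - g n t\<bar>}"
        by (simp add: abs_minus_commute)
      then have "cdf (\<mu>s n) x \<le> cdf \<mu> (x + \<delta>) + \<delta>" "cdf \<mu> (x - \<delta>) \<le> cdf (\<mu>s n) x + \<delta>"
        using elim cdf_distr_le_shift[of "f n" "g n" \<delta> x]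
          cdf_distr_le_shift[of "g n" "f n" \<delta> "x - \<delta>"] by auto
      then show ?case
        using d(2)[of "x + \<delta>"] d(2)[of "x - \<delta>"] \<delta>
        unfolding dist_real_def by linarith
    qed
  qed
qed

lemma prob_space_unit_interval: "prob_space unit_interval_measure"
  by (auto simp: space_restrict_space emeasure_restrict_space intro!: prob_spaceI)

lemma dKF_less_imp_close:
  assumes [measurable]: "f \<in> borel_measurable unit_interval_measure"
      "g \<in> borel_measurable unit_interval_measure"
    and "dKF f g < \<delta>"
  shows "measure unit_interval_measure {t \<in> space unit_interval_measure. \<delta> < \<bar>f t - g t\<bar>} \<le> \<delta>"
proof -
  interpret prob_space unit_interval_measure by (rule prob_space_unit_interval)
  have space: "space unit_interval_measure = {0..<1}"
    by (simp add: space_restrict_space)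
  let ?E = "{\<epsilon>. 0 \<le> \<epsilon> \<and> prob {t \<in> {0..<1}. \<epsilon> < \<bar>f t - g t\<bar>} \<le> \<epsilon>}"
  have "1 \<in> ?E"
    using prob_le_1 by simp
  then obtain \<epsilon> where \<epsilon>: "\<epsilon> \<in> ?E" "\<epsilon> < \<delta>"
    using assms(3) cInf_lessD[of ?E \<delta>] unfolding dKF_def by blast
  have "prob {t \<in> space unit_interval_measure. \<delta> < \<bar>f t - g t\<bar>}
      \<le> prob {t \<in> space unit_interval_measure. \<epsilon> < \<bar>f t - g t\<bar>}"
  proof (rule finite_measure_mono)
    show "{t \<in> space unit_interval_measure. \<epsilon> < \<bar>f t - g t\<bar>} \<in> events"
      by measurable
  qed (use \<epsilon> in auto)
  then show ?thesis
    using \<epsilon> by (simp add: space)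
qed

section \<open>Measurements along a sequence converging in the observable distance\<close>

lemma borel_measurable_Lip1:
  assumes "mm_space X" "f \<in> Lip1 (fst X)"
  shows "f \<in> borel_measurable (snd X)"
proof -
  let ?d = "fst X"
  have "Lipschitz_continuous_map ?d euclidean_metric f"
    using assms(2) unfolding Lipschitz_continuous_map_def Lip1_def
    by (auto simp: dist_real_def intro!: exI[of _ 1])
  then have cont: "continuous_map (mtopology_of ?d) euclidean f"
    using Lipschitz_continuous_imp_continuous_map by fastforce
  have sub: "{U. openin (mtopology_of ?d) U} \<subseteq> Pow (mspace ?d)"
    using openin_subset by fastforce
  have "f \<in> borel_measurable (metric_borel ?d)"
  proof (rule borel_measurableI)
    fix U :: "real set" assume "open U"
    then have "openin (mtopology_of ?d) {x \<in> mspace ?d. f x \<in> U}"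
      using openin_continuous_map_preimage[OF cont, of U] by simp
    moreover have "f -` U \<inter> space (metric_borel ?d) = {x \<in> mspace ?d. f x \<in> U}"
      using sub by (auto simp: metric_borel_def space_measure_of)
    ultimately show "f -` U \<inter> space (metric_borel ?d) \<in> sets (metric_borel ?d)"
      using sub by (simp add: metric_borel_def sets_measure_of sigma_sets.Basic)
  qed
  then show ?thesis
    using assms(1) by (simp add: mm_space_def cong: measurable_cong_sets)
qed

lemma real_distribution_measurement1:
  assumes "mm_space X" "\<mu> \<in> measurement1 X"
  shows "real_distribution \<mu>"
  using assms borel_measurable_Lip1[OF assms(1)] prob_space.real_distribution_distr
  unfolding measurement1_def mm_space_def by blast

lemma parameter_pullback:
  assumes "mm_space X" "f \<in> Lip1 (fst X)" "\<phi> \<in> parameters X"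
  shows "f \<circ> \<phi> \<in> borel_measurable unit_interval_measure"
    and "distr unit_interval_measure borel (f \<circ> \<phi>) = distr (snd X) borel f"
proof -
  have f: "f \<in> borel_measurable (snd X)"
    using assms borel_measurable_Lip1 by blast
  have \<phi>: "\<phi> \<in> measurable unit_interval_measure (snd X)"
      "distr unit_interval_measure (snd X) \<phi> = snd X"
    using assms by (auto simp: parameters_def)
  show "f \<circ> \<phi> \<in> borel_measurable unit_interval_measure"
    using f \<phi>(1) by (rule measurable_comp[rotated])
  show "distr unit_interval_measure borel (f \<circ> \<phi>) = distr (snd X) borel f"
    using distr_distr[OF f \<phi>(1)] \<phi>(2) by simp
qed

text \<open>The parameters depend on \<open>\<delta>\<close>, since the infimum over them need not be attained. The partner
  \<open>h\<close> comes from the directed half of the Hausdorff distance that starts at functions on \<open>X\<close>.\<close>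

lemma dconc_less_imp_close:
  assumes "dconc Y X < ennreal \<delta>" "f \<in> Lip1 (fst X)"
  obtains h \<phi> \<psi> where "h \<in> Lip1 (fst Y)" "\<phi> \<in> parameters Y" "\<psi> \<in> parameters X"
    "dKF (h \<circ> \<phi>) (f \<circ> \<psi>) < \<delta>"
proof -
  obtain \<phi> \<psi> where par: "\<phi> \<in> parameters Y" "\<psi> \<in> parameters X"
    and less: "hausdorff_distance dKF (param_Lip1 \<phi> Y) (param_Lip1 \<psi> X) < ennreal \<delta>"
    using assms(1) unfolding dconc_def INF_less_iff by blast
  have "(INF a\<in>param_Lip1 \<phi> Y. ennreal (dKF a (f \<circ> \<psi>)))
      \<le> (SUP b\<in>param_Lip1 \<psi> X. INF a\<in>param_Lip1 \<phi> Y. ennreal (dKF a b))"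
    unfolding param_Lip1_def by (intro SUP_upper imageI assms(2))
  also have "\<dots> < ennreal \<delta>"
    using less by (simp add: hausdorff_distance_def)
  finally obtain h where "h \<in> Lip1 (fst Y)" "ennreal (dKF (h \<circ> \<phi>) (f \<circ> \<psi>)) < ennreal \<delta>"
    unfolding INF_less_iff param_Lip1_def by auto
  then show thesis
    using that par by (metis ennreal_leI not_le)
qed

theorem measurement1_weak_approximation:
  assumes X: "mm_space X" and Xs: "\<forall>\<^sub>F n in sequentially. mm_space (Xs n)"
    and conv: "(\<lambda>n. dconc (Xs n) X) \<longlonglongrightarrow> 0" and \<mu>: "\<mu> \<in> measurement1 X"
  obtains \<mu>s where "\<forall>\<^sub>F n in sequentially. \<mu>s n \<in> measurement1 (Xs n)" "weak_conv_m \<mu>s \<mu>"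
proof -
  interpret prob_space unit_interval_measure by (rule prob_space_unit_interval)
  obtain f where f: "f \<in> Lip1 (fst X)" "\<mu> = distr (snd X) borel f"
    using \<mu> by (auto simp: measurement1_def)
  \<comment> \<open>The summand \<open>1 / Suc n\<close> makes the bound strict, as required to pick parameters whose
    Hausdorff distance stays below it.\<close>
  define \<delta> where "\<delta> n = enn2real (dconc (Xs n) X) + 1 / real (Suc n)" for n
  have "(\<lambda>n. enn2real (dconc (Xs n) X)) \<longlonglongrightarrow> 0"
    using tendsto_enn2real[of "\<lambda>n. dconc (Xs n) X" 0] conv by simp
  then have "\<delta> \<longlonglongrightarrow> 0 + 0"
    unfolding \<delta>_def using LIMSEQ_inverse_real_of_nat
    by (intro tendsto_add) (simp_all add: inverse_eq_divide)
  then have \<delta>: "\<delta> \<longlonglongrightarrow> 0" by simp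
  have "\<forall>\<^sub>F n in sequentially. dconc (Xs n) X < ennreal (\<delta> n)"
    using order_tendstoD(2)[OF conv, of top, simplified]
  proof eventually_elim
    case (elim n)
    then have "dconc (Xs n) X = ennreal (enn2real (dconc (Xs n) X))"
      by (simp add: less_top)
    also have "\<dots> < ennreal (\<delta> n)"
      by (intro ennreal_lessI) (auto simp: \<delta>_def add_nonneg_pos)
    finally show ?case .
  qed
  then have "\<forall>\<^sub>F n in sequentially. \<exists>h \<phi> \<psi>. h \<in> Lip1 (fst (Xs n)) \<and> \<phi> \<in> parameters (Xs n) \<and>
      \<psi> \<in> parameters X \<and> dKF (h \<circ> \<phi>) (f \<circ> \<psi>) < \<delta> n"
    by eventually_elim (metis dconc_less_imp_close f(1))
  then obtain h \<phi> \<psi> where close: "\<forall>\<^sub>F n in sequentially. h n \<in> Lip1 (fst (Xs n)) \<and>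
      \<phi> n \<in> parameters (Xs n) \<and> \<psi> n \<in> parameters X \<and> dKF (h n \<circ> \<phi> n) (f \<circ> \<psi> n) < \<delta> n"
    unfolding eventually_ex by blast
  define \<mu>s where "\<mu>s n = distr (snd (Xs n)) borel (h n)" for n
  show thesis
  proof
    show "\<forall>\<^sub>F n in sequentially. \<mu>s n \<in> measurement1 (Xs n)"
      using close by eventually_elim (auto simp: \<mu>s_def measurement1_def)
    show "weak_conv_m \<mu>s \<mu>"
    proof (rule weak_conv_m_of_close_in_measure[of "\<lambda>n. h n \<circ> \<phi> n" "\<lambda>n. f \<circ> \<psi> n"])
      fix e :: real assume "0 < e"
      then have "\<forall>\<^sub>F n in sequentially. \<delta> n < e"
        using \<delta> order_tendstoD(2) by blast
      then show "\<forall>\<^sub>F n in sequentially. h n \<circ> \<phi> n \<in> borel_measurable unit_interval_measure \<and>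
          f \<circ> \<psi> n \<in> borel_measurable unit_interval_measure \<and>
          distr unit_interval_measure borel (h n \<circ> \<phi> n) = \<mu>s n \<and>
          distr unit_interval_measure borel (f \<circ> \<psi> n) = \<mu> \<and>
          prob {t \<in> space unit_interval_measure. e < \<bar>(h n \<circ> \<phi> n) t - (f \<circ> \<psi> n) t\<bar>} \<le> e"
        using close Xs
      proof eventually_elim
        case (elim n)
        then have "dKF (h n \<circ> \<phi> n) (f \<circ> \<psi> n) < e" by linarith
        with elim f X show ?case
          by (simp only: parameter_pullback \<mu>s_def dKF_less_imp_close simp_thms)
      qed
    qed
  qed
qed

section \<open>Stability of iso-dominants\<close>

theorem theorem1p9:
  fixes X :: "'a mmspace" and Xs :: "nat \<Rightarrow> 'b mmspace"
    and \<nu> :: "real measure" and \<nu>s :: "nat \<Rightarrow> real measure"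
    and \<epsilon> :: real and \<epsilon>s :: "nat \<Rightarrow> real"
  assumes "mm_space X" and "\<And>n. n \<ge> 1 \<Longrightarrow> mm_space (Xs n)"
    and "real_distribution \<nu>" and "\<And>n. n \<ge> 1 \<Longrightarrow> real_distribution (\<nu>s n)"
    and "\<And>n. n \<ge> 1 \<Longrightarrow> \<epsilon>s n \<ge> 0"
    and "(\<lambda>n. dconc (Xs n) X) \<longlonglongrightarrow> 0"
    and "weak_conv_m \<nu>s \<nu>"
    and "\<epsilon>s \<longlonglongrightarrow> \<epsilon>"
    and "\<And>n. n \<ge> 1 \<Longrightarrow> iso_dominant (\<epsilon>s n) (Xs n) (\<nu>s n)"
  shows "iso_dominant \<epsilon> X \<nu>"
  unfolding iso_dominant_def
proof
  fix \<mu> assume \<mu>: "\<mu> \<in> measurement1 X"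
  have pos: "\<forall>\<^sub>F n in sequentially. (n::nat) \<ge> 1"
    by (rule eventually_ge_at_top)
  then have "\<forall>\<^sub>F n in sequentially. mm_space (Xs n)"
    by eventually_elim (rule assms(2))
  then obtain \<mu>s where \<mu>s: "\<forall>\<^sub>F n in sequentially. \<mu>s n \<in> measurement1 (Xs n)" "weak_conv_m \<mu>s \<mu>"
    using measurement1_weak_approximation[OF assms(1) _ assms(6) \<mu>] by blast
  have "\<forall>\<^sub>F n in sequentially. succ_err (\<epsilon>s n) 0 (\<nu>s n) (\<mu>s n)"
    using pos \<mu>s(1) by eventually_elim (use assms(9) iso_dominant_def in blast)
  then show "succ_err \<epsilon> 0 \<nu> \<mu>"
    using succ_err_zero_weak_limit[OF assms(3) real_distribution_measurement1[OF assms(1) \<mu>]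
        assms(7) \<mu>s(2) assms(8)] by blast
qed

end
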